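(* Let $\mathcal{L} \subseteq \mathbb{S}^n$ be a linear subspace and $C, Y \in \mathbb{S}^n$. Let $\mathcal{W} \subseteq \mathbb{S}^n$ be any admissible subspace. Let the optimal admissible subspace $\mathcal{S}_{opt}$ and $\mathcal{W}$ have the following direct-sum decompositions into simple ideals: $$\mathcal{S}_{opt} = \oplus_{i=1}^{s} \mathcal{S}_i, \qquad \mathcal{W} = \oplus_{k=1}^{w} \mathcal{W}_k .$$ Then $r_{\mathcal{W}} := (\mathrm{rank}\,\mathcal{W}_1, \ldots, \mathrm{rank}\,\mathcal{W}_w)$ weakly majorizes $r_{\mathcal{S}_{opt}} := (\mathrm{rank}\,\mathcal{S}_1, \ldots, \mathrm{rank}\,\mathcal{S}_s)$.
   Context: $\mathbb{S}^n$ is the space of real symmetric $n\times n$ matrices with the trace inner product $X\cdot Y := \mathrm{Tr}(XY)$ and Jordan product $X\circ Y := \frac12(XY+YX)$; $\mathbb{S}^n_+$ is the positive semidefinite cone; $P_{\mathcal{S}}$ denotes orthogonal projection onto a subspace $\mathcal{S}$. Admissibility (relative to $C,Y,\mathcal{L}$): a subspace $\mathcal{S} \subseteq \mathbb{S}^n$ is admissible if $P_{\mathcal{S}}$ satisfies: (a) $P_{\mathcal{S}}(\mathbb{S}^n_+)\subseteq \mathbb{S}^n_+$; (b) $P_{\mathcal{S}}(Y+\mathcal{L})\subseteq Y+\mathcal{L}$; (c) $P_{\mathcal{S}}(C+\mathcal{L}^\perp)\subseteq C+\mathcal{L}^\perp$; (d) there exists $E\in\mathcal{S}$ with $X\circ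 E = X$ for all $X\in\mathcal{S}$. $\mathcal{S}_{opt}$ is the intersection of all admissible subspaces, and is itself admissible. Every admissible subspace is a Jordan subalgebra of $\mathbb{S}^n$ (closed under $\circ$), hence a Euclidean Jordan algebra in its own right. An ideal of a Jordan algebra $\mathcal{J}$ is a subspace $\mathcal{I}$ with $x\circ y\in\mathcal{I}$ for all $x\in\mathcal{I}$, $y\in\mathcal{J}$. A nonzero algebra is simple if its only ideals are $\{0\}$ and itself; an ideal is simple if it is simple when viewed as an algebra. Every subalgebra of $\mathbb{S}^n$ is an orthogonal direct sum of simple ideals. The rank of a simple ideal $\mathcal{W}_i$ is the maximum number of distinct eigenvalues of an element $X\in\mathcal{W}_i$, where eigenvalues are those in the spectral decomposition of $X$ inside the Jordan algebra $\mathcal{W}_i$ (with its own unit). Equivalently, it is the maximum number of pairwise orthogonal nonzero idempotents in $\mathcal{W}_i$. E.g. $\mathrm{rank}\,\mathbb{S}^m = m$. Weak majorization: $x\in\mathbb{Z}^m$ weakly majorizes $y\in\mathbb{Z}^{n}$ if $\sum_{i=1}^{\min\{\ell,m\}} [x^{\downarrow}]_i \ge \sum_{i=1}^{\min\{\ell,n\}} [y^{\downarrow}]_i$ for all $\ell\in\{1,\ldots,\max\{m,n\}\}$, where $x^{\downarrow}, y^{\downarrow}$ are $x,y$ with entries sorted in descending order. *)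

theory Defs
  imports "HOL-Analysis.Analysis"
begin

definition sym_mats :: "(real^'n^'n) set" where
  "sym_mats = {X. transpose X = X}"

definition psd_cone :: "(real^'n^'n) set" where
  "psd_cone = {X \<in> sym_mats. \<forall>v. 0 \<le> v \<bullet> (X *v v)}"

definition tr_inner :: "real^'n^'n \<Rightarrow> real^'n^'n \<Rightarrow> real" where
  "tr_inner X Y = trace (X ** Y)"

definition jordan_prod :: "real^'n^'n \<Rightarrow> real^'n^'n \<Rightarrow> real^'n^'n"  (infixl "\<circ>\<^sub>J" 70) where
  "X \<circ>\<^sub>J Y = (1/2) *\<^sub>R (X ** Y + Y ** X)"

text \<open>The trace inner product is positive definite only on symmetric matrices, so the next two
  notions are meant for subspaces of \<^const>\<open>sym_mats\<close>, and the complement is taken inside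
  \<^const>\<open>sym_mats\<close>.\<close>

definition orth_compl :: "(real^'n^'n) set \<Rightarrow> (real^'n^'n) set" where
  "orth_compl L = {X \<in> sym_mats. \<forall>Z\<in>L. tr_inner X Z = 0}"

definition orth_proj :: "(real^'n^'n) set \<Rightarrow> real^'n^'n \<Rightarrow> real^'n^'n" where
  "orth_proj S X = (THE P. P \<in> S \<and> (\<forall>Z\<in>S. tr_inner (X - P) Z = 0))"

definition jordan_unit :: "(real^'n^'n) set \<Rightarrow> real^'n^'n \<Rightarrow> bool" where
  "jordan_unit J E \<longleftrightarrow> E \<in> J \<and> (\<forall>X\<in>J. X \<circ>\<^sub>J E = X)"

definition admissible ::
  "real^'n^'n \<Rightarrow> real^'n^'n \<Rightarrow> (real^'n^'n) set \<Rightarrow> (real^'n^'n) set \<Rightarrow> bool" where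
  "admissible C Y L S \<longleftrightarrow>
     subspace S \<and> S \<subseteq> sym_mats \<and>
     orth_proj S ` psd_cone \<subseteq> psd_cone \<and>
     orth_proj S ` ((+) Y ` L) \<subseteq> (+) Y ` L \<and>
     orth_proj S ` ((+) C ` orth_compl L) \<subseteq> (+) C ` orth_compl L \<and>
     (\<exists>E. jordan_unit S E)"

definition S_opt :: "real^'n^'n \<Rightarrow> real^'n^'n \<Rightarrow> (real^'n^'n) set \<Rightarrow> (real^'n^'n) set" where
  "S_opt C Y L = \<Inter> {S. admissible C Y L S}"

definition jordan_ideal :: "(real^'n^'n) set \<Rightarrow> (real^'n^'n) set \<Rightarrow> bool" where
  "jordan_ideal I J \<longleftrightarrow> subspace I \<and> I \<subseteq> J \<and> (\<forall>X\<in>I. \<forall>Y\<in>J. X \<circ>\<^sub>J Y \<in> I)"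

definition jordan_simple :: "(real^'n^'n) set \<Rightarrow> bool" where
  "jordan_simple J \<longleftrightarrow> J \<noteq> {0} \<and> (\<forall>I. jordan_ideal I J \<longrightarrow> I = {0} \<or> I = J)"

definition simple_ideal :: "(real^'n^'n) set \<Rightarrow> (real^'n^'n) set \<Rightarrow> bool" where
  "simple_ideal I J \<longleftrightarrow> jordan_ideal I J \<and> jordan_simple I"

text \<open>Internal direct sum of the listed subspaces: addition is a bijection from their product
  onto \<open>J\<close>. The empty list decomposes exactly \<open>{0}\<close>.\<close>

definition direct_sum_of :: "(real^'n^'n) set \<Rightarrow> (real^'n^'n) set list \<Rightarrow> bool" where
  "direct_sum_of J As \<longleftrightarrow>
     bij_betw (\<lambda>f. \<Sum>i<length As. f i) (\<Pi>\<^sub>E i\<in>{..<length As}. As ! i) J"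

definition simple_ideal_decomposition ::
  "(real^'n^'n) set \<Rightarrow> (real^'n^'n) set list \<Rightarrow> bool" where
  "simple_ideal_decomposition J As \<longleftrightarrow>
     direct_sum_of J As \<and> (\<forall>A\<in>set As. simple_ideal A J)"

text \<open>Spectral decomposition \<open>X = (\<Sum>\<lambda>\<in>\<Lambda>. \<lambda> E\<^sub>\<lambda>)\<close> inside the algebra \<open>J\<close>: the \<open>E\<^sub>\<lambda>\<close> are nonzero,
  pairwise orthogonal idempotents of \<open>J\<close> summing to the unit of \<open>J\<close> (not of the ambient algebra).
  Indexing by the eigenvalues makes them distinct.\<close>

definition spectral_decomposition ::
  "(real^'n^'n) set \<Rightarrow> real^'n^'n \<Rightarrow> real set \<Rightarrow> (real \<Rightarrow> real^'n^'n) \<Rightarrow> bool" where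
  "spectral_decomposition J X \<Lambda> E \<longleftrightarrow>
     finite \<Lambda> \<and>
     (\<forall>l\<in>\<Lambda>. E l \<in> J \<and> E l \<noteq> 0 \<and> E l \<circ>\<^sub>J E l = E l) \<and>
     (\<forall>l\<in>\<Lambda>. \<forall>m\<in>\<Lambda>. l \<noteq> m \<longrightarrow> E l \<circ>\<^sub>J E m = 0) \<and>
     jordan_unit J (\<Sum>l\<in>\<Lambda>. E l) \<and>
     X = (\<Sum>l\<in>\<Lambda>. l *\<^sub>R E l)"

definition jordan_eigenvalues :: "(real^'n^'n) set \<Rightarrow> real^'n^'n \<Rightarrow> real set" where
  "jordan_eigenvalues J X = {l. \<exists>\<Lambda> E. spectral_decomposition J X \<Lambda> E \<and> l \<in> \<Lambda>}"

definition jordan_rank :: "(real^'n^'n) set \<Rightarrow> nat" where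
  "jordan_rank J = Max ((\<lambda>X. card (jordan_eigenvalues J X)) ` J)"

definition rank_vector :: "(real^'n^'n) set list \<Rightarrow> int list" where
  "rank_vector As = map (\<lambda>A. int (jordan_rank A)) As"

definition descending :: "int list \<Rightarrow> int list" where
  "descending x = rev (sort x)"

definition weakly_majorizes :: "int list \<Rightarrow> int list \<Rightarrow> bool" where
  "weakly_majorizes x y \<longleftrightarrow>
     (\<forall>l\<in>{1..max (length x) (length y)}.
        (\<Sum>i<min l (length x). descending x ! i) \<ge> (\<Sum>i<min l (length y). descending y ! i))"

end

(*
  Only two consequences of admissibility matter: S_opt is contained in W, and W has a unit. Each
  summand W_k then has a unit U_k, and X |-> X o U_k is the projection W -> W_k, a Jordan
  homomorphism. Its kernel in a simple summand S_i is an ideal, so for some k = f(i) it is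
  injective on S_i. For fixed k, maximal families of orthogonal idempotents of all the S_i with
  f(i) = k are jointly mapped to orthogonal nonzero idempotents of W_k; hence the ranks of these
  S_i add up to at most rank W_k, and the majorization follows by grouping along f.
*)

theory Submission
  imports Defs "HOL-Combinatorics.List_Permutation"
begin

section \<open>Weak majorization\<close>

text \<open>Turns sums over leading positions of the sorted list into sums over index sets of the
  original list.\<close>

lemma descending_permutation:
  obtains p where "p permutes {..<length x}" "\<And>i. i < length x \<Longrightarrow> descending x ! i = x ! p i"
proof -
  have "mset (descending x) = mset x" by (simp add: descending_def)
  then obtain p where p: "p permutes {..<length x}" "permute_list p x = descending x"
    using mset_eq_permutation by blast
  show thesis
    using p permute_list_nth[OF p(1)] that by metis
qed

lemma length_descending [simp]: "length (descending x) = length x"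
  by (simp add: descending_def)

lemma descending_nth_mono:
  assumes "i \<le> j" "j < length x"
  shows "descending x ! j \<le> descending x ! i"
  using assms by (simp add: descending_def rev_nth sorted_nth_mono)

text \<open>An exchange argument: \<open>K\<close> is carried to a set \<open>M\<close> of positions
  in the sorted list, and the positions of \<open>M\<close> from \<open>m\<close> on are traded for
  positions below \<open>m\<close> outside \<open>M\<close>. No position is lost because
  \<open>M\<close> has at most \<open>m\<close> elements. Nonnegativity covers the case of fewer
  than \<open>m\<close>.\<close>

lemma sum_le_sum_descending:
  assumes nonneg: "\<And>i. i < length x \<Longrightarrow> 0 \<le> x ! i"
    and K: "K \<subseteq> {..<length x}" and m: "card K \<le> m" "m \<le> length x"
  shows "(\<Sum>k\<in>K. x ! k) \<le> (\<Sum>i<m. descending x ! i)"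
proof (cases "m = 0")
  case True
  have "finite K" using K finite_subset by blast
  with True m show ?thesis by simp
next
  case False
  obtain p where p: "p permutes {..<length x}"
    and nth: "\<And>i. i < length x \<Longrightarrow> descending x ! i = x ! p i"
    using descending_permutation by metis
  define M where "M = inv p ` K"
  \<comment> \<open>The threshold of the exchange: sorted entries from position \<open>m\<close> on
    are at most \<open>t\<close>, those before it at least \<open>t\<close>. The case
    \<open>m = 0\<close> was split off so that \<open>m - 1\<close> is a genuine position.\<close>
  define t where "t = descending x ! (m - 1)"
  have inv: "inv p permutes {..<length x}" using p by (rule permutes_inv)
  have M: "M \<subseteq> {..<length x}"
    unfolding M_def using K permutes_image[OF inv] by blast
  have fin: "finite M" using M finite_subset by blast
  have inj: "inj_on (inv p) K" using permutes_inj_on[OF inv] .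
  have card_M: "card M \<le> m" using card_image[OF inj] m by (simp add: M_def)
  have t: "0 \<le> t"
  proof -
    have "p (m - 1) < length x" using permutes_in_image[OF p, of "m - 1"] False m by simp
    then show ?thesis unfolding t_def using nth[of "m - 1"] nonneg False m by simp
  qed
  have "(\<Sum>k\<in>K. x ! k) = (\<Sum>k\<in>K. descending x ! inv p k)"
  proof (rule sum.cong)
    fix k assume "k \<in> K"
    then have "inv p k < length x" using M by (auto simp: M_def)
    then show "x ! k = descending x ! inv p k" using nth permutes_inverses(1)[OF p] by simp
  qed simp
  also have "\<dots> = (\<Sum>i\<in>M. descending x ! i)"
    unfolding M_def using inj by (simp add: sum.reindex)
  also have "\<dots> = (\<Sum>i\<in>M \<inter> {..<m}. descending x ! i) + (\<Sum>i\<in>M - {..<m}. descending x ! i)"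
    using fin by (metis sum.Int_Diff)
  also have "(\<Sum>i\<in>M - {..<m}. descending x ! i) \<le> of_nat (card (M - {..<m})) * t"
    unfolding t_def by (rule sum_bounded_above) (use M in \<open>auto intro!: descending_nth_mono\<close>)
  also have "\<dots> \<le> of_nat (card ({..<m} - M)) * t"
  proof -
    have "card (M - {..<m}) + card (M \<inter> {..<m}) = card M"
      using fin card_Diff_subset_Int[of M "{..<m}"] card_mono[OF fin, of "M \<inter> {..<m}"] by auto
    moreover have "card ({..<m} - M) + card (M \<inter> {..<m}) = m"
      using card_Diff_subset_Int[of "{..<m}" M] card_mono[of "{..<m}" "M \<inter> {..<m}"]
      by (auto simp: Int_commute)
    ultimately have "card (M - {..<m}) \<le> card ({..<m} - M)" using card_M by linarith
    then show ?thesis using t by (simp add: mult_right_mono)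
  qed
  also have "\<dots> \<le> (\<Sum>i\<in>{..<m} - M. descending x ! i)"
    unfolding t_def by (rule sum_bounded_below) (use m in \<open>auto intro!: descending_nth_mono\<close>)
  also have "(\<Sum>i\<in>M \<inter> {..<m}. descending x ! i) + (\<Sum>i\<in>{..<m} - M. descending x ! i) =
      (\<Sum>i<m. descending x ! i)"
    by (metis finite_lessThan inf_commute sum.Int_Diff)
  finally show ?thesis by simp
qed

text \<open>The \<open>l\<close> largest entries of \<open>y\<close> are grouped along
  \<open>f\<close>. They meet at most \<open>l\<close> fibres, each bounded by one entry of
  \<open>x\<close>, so the \<open>l\<close> largest entries of \<open>x\<close> suffice.\<close>

lemma weakly_majorizesI:
  assumes f: "\<And>i. i < length y \<Longrightarrow> f i < length x"
    and fibre: "\<And>k. k < length x \<Longrightarrow> (\<Sum>i | i < length y \<and> f i = k. y ! i) \<le> x ! k"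
    and nonneg: "\<And>i. i < length y \<Longrightarrow> 0 \<le> y ! i"
  shows "weakly_majorizes x y"
  unfolding weakly_majorizes_def
proof
  fix l assume "l \<in> {1..max (length x) (length y)}"
  define m where "m = min l (length y)"
  obtain p where p: "p permutes {..<length y}"
    and nth: "\<And>i. i < length y \<Longrightarrow> descending y ! i = y ! p i"
    using descending_permutation by metis
  \<comment> \<open>The original positions of the \<open>m\<close> largest entries of
    \<open>y\<close>.\<close>
  define I where "I = p ` {..<m}"
  have I: "I \<subseteq> {..<length y}"
    unfolding I_def m_def using permutes_image[OF p] by (metis image_mono lessThan_subset_iff min.cobounded2)
  have fin: "finite I" by (simp add: I_def)
  have x_nonneg: "0 \<le> x ! k" if "k < length x" for k
    using fibre[OF that] sum_nonneg[of "{i. i < length y \<and> f i = k}" "(!) y"] nonneg by force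
  have "(\<Sum>i<m. descending y ! i) = (\<Sum>i<m. y ! p i)"
    by (rule sum.cong) (auto simp: m_def nth)
  also have "\<dots> = (\<Sum>i\<in>I. y ! i)"
    unfolding I_def by (subst sum.reindex) (auto simp: permutes_inj_on[OF p])
  also have "\<dots> = (\<Sum>k\<in>f ` I. \<Sum>i | i \<in> I \<and> f i = k. y ! i)"
    using sum.image_gen[OF fin] .
  also have "\<dots> \<le> (\<Sum>k\<in>f ` I. x ! k)"
  proof (rule sum_mono)
    fix k assume "k \<in> f ` I"
    then have k: "k < length x" using I f by auto
    \<comment> \<open>Completing the part of the fibre inside \<open>I\<close> to the whole fibre
      only adds nonnegative entries.\<close>
    have "(\<Sum>i | i \<in> I \<and> f i = k. y ! i) \<le> (\<Sum>i | i < length y \<and> f i = k. y ! i)"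
      by (rule sum_mono2) (use I nonneg in auto)
    also have "\<dots> \<le> x ! k" using fibre[OF k] .
    finally show "(\<Sum>i | i \<in> I \<and> f i = k. y ! i) \<le> x ! k" .
  qed
  also have "\<dots> \<le> (\<Sum>i<min l (length x). descending x ! i)"
  proof (rule sum_le_sum_descending)
    show sub: "f ` I \<subseteq> {..<length x}" using I f by auto
    have "card (f ` I) \<le> card I" using fin by (rule card_image_le)
    also have "\<dots> \<le> m" unfolding I_def using card_image_le[of "{..<m}" p] by simp
    finally have "card (f ` I) \<le> l" by (simp add: m_def)
    moreover have "card (f ` I) \<le> length x" using card_mono[OF _ sub] by simp
    ultimately show "card (f ` I) \<le> min l (length x)" by simp
  qed (use x_nonneg in auto)
  finally show "(\<Sum>i<min l (length y). descending y ! i) \<le> (\<Sum>i<min l (length x). descending x ! i)"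
    by (simp add: m_def)
qed

section \<open>Orthogonal idempotents and the rank\<close>

lemma matrix_add_rdistrib:
  fixes A B C :: "real^'n^'n"
  shows "(A + B) ** C = A ** C + B ** C"
  by (simp add: vec_eq_iff matrix_matrix_mult_def sum.distrib distrib_right)

lemma scaleR_matrix_mult_left:
  fixes A B :: "real^'n^'n"
  shows "(c *\<^sub>R A) ** B = c *\<^sub>R (A ** B)"
  by (simp add: vec_eq_iff matrix_matrix_mult_def sum_distrib_left mult.assoc)

lemma scaleR_matrix_mult_right:
  fixes A B :: "real^'n^'n"
  shows "A ** (c *\<^sub>R B) = c *\<^sub>R (A ** B)"
  by (simp add: vec_eq_iff matrix_matrix_mult_def sum_distrib_left algebra_simps)

lemma jordan_prod_commute: "X \<circ>\<^sub>J Y = Y \<circ>\<^sub>J X"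
  by (simp add: jordan_prod_def add.commute)

lemma bilinear_jordan_prod: "bilinear (\<circ>\<^sub>J)"
proof -
  have "linear (\<lambda>X. X \<circ>\<^sub>J Y)" for Y :: "real^'n^'n"
    by (rule linearI)
      (simp_all add: jordan_prod_def vec_eq_iff matrix_matrix_mult_def sum.distrib sum_distrib_left
        algebra_simps)
  moreover from this have "linear (\<lambda>Y. X \<circ>\<^sub>J Y)" for X :: "real^'n^'n"
    by (simp add: jordan_prod_commute[of X])
  ultimately show ?thesis
    unfolding bilinear_def by blast
qed

interpretation jordan_prod: bounded_bilinear jordan_prod
  using bilinear_jordan_prod bilinear_conv_bounded_bilinear by blast

lemma idempotent_iff: "E \<circ>\<^sub>J E = E \<longleftrightarrow> E ** E = E"
  by (simp add: jordan_prod_def flip: scaleR_2)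

text \<open>Jordan orthogonality says that \<open>E\<close> and \<open>F\<close> anticommute. Moving
  one factor \<open>E\<close> of \<open>E ** E ** F\<close> past \<open>F\<close> twice gives
  \<open>E ** F = F ** E\<close>, so the product equals its own negative.\<close>

lemma matrix_mult_eq_0:
  assumes E: "E \<circ>\<^sub>J E = E" and F: "F \<circ>\<^sub>J F = F" and EF: "E \<circ>\<^sub>J F = 0"
  shows "E ** F = 0"
proof -
  have E2: "E ** E = E" and F2: "F ** F = F" using E F by (simp_all add: idempotent_iff)
  have anti: "E ** F = - (F ** E)"
    using EF by (simp add: jordan_prod_def eq_neg_iff_add_eq_0)
  have neg: "(- A) ** B = - (A ** B)" "A ** (- B) = - (A ** B)" for A B :: "real^'n^'n"
    by (simp_all add: vec_eq_iff matrix_matrix_mult_def sum_negf)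
  have "E ** F = E ** (E ** F)" using E2 by (simp add: matrix_mul_assoc)
  also have "\<dots> = - (E ** F ** E)" by (simp add: anti neg matrix_mul_assoc)
  also have "\<dots> = F ** E ** E" by (simp add: anti neg)
  also have "\<dots> = F ** E" using E2 by (simp flip: matrix_mul_assoc)
  finally have "E ** F = - (E ** F)" using anti by simp
  then show ?thesis by (simp add: eq_neg_iff_add_eq_0 flip: scaleR_2)
qed

text \<open>Multiplying \<open>X ** U + U ** X = 2 *\<^sub>R X\<close> by \<open>U\<close> on the
  left and on the right shows that \<open>U ** X\<close> and \<open>X ** U\<close> both equal
  \<open>U ** X ** U\<close>. Thus they coincide, and each is \<open>X\<close>.\<close>

lemma idempotent_unit_mult:
  assumes U: "U \<circ>\<^sub>J U = U" and X: "X \<circ>\<^sub>J U = X"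
  shows "U ** X = X"
proof -
  have U2: "U ** U = U" using U by (simp add: idempotent_iff)
  have two: "X ** U + U ** X = 2 *\<^sub>R X"
  proof -
    have "2 *\<^sub>R (X \<circ>\<^sub>J U) = X ** U + U ** X" by (simp add: jordan_prod_def)
    then show ?thesis using X by simp
  qed
  have "U ** (X ** U + U ** X) = U ** (2 *\<^sub>R X)" "(X ** U + U ** X) ** U = (2 *\<^sub>R X) ** U"
    using two by simp_all
  then have "U ** X ** U + U ** X = 2 *\<^sub>R (U ** X)" "X ** U + U ** X ** U = 2 *\<^sub>R (X ** U)"
    using U2
    by (simp_all add: matrix_add_ldistrib matrix_mul_assoc matrix_add_rdistrib scaleR_matrix_mult_left
      scaleR_matrix_mult_right)
       (simp flip: matrix_mul_assoc)
  then have "U ** X ** U = U ** X" "U ** X ** U = X ** U"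
    by (simp_all add: scaleR_2)
  then have "X ** U = U ** X" by simp
  then show ?thesis using two by (simp flip: scaleR_2)
qed

text \<open>A spectral decomposition stripped of its eigenvalues and of the demand that the
  idempotents sum to the unit. Excluding 0 makes such a set linearly independent.\<close>

definition orthogonal_idempotents :: "(real^'n^'n) set \<Rightarrow> bool" where
  "orthogonal_idempotents F \<longleftrightarrow>
     0 \<notin> F \<and> (\<forall>E\<in>F. E \<circ>\<^sub>J E = E) \<and> (\<forall>E\<in>F. \<forall>E'\<in>F. E \<noteq> E' \<longrightarrow> E \<circ>\<^sub>J E' = 0)"

text \<open>Multiplication by a member reads off its coefficient. This yields linear independence,
  and with all coefficients 1 it makes the sum of a family act as a unit on its members.\<close>

lemma orthogonal_idempotents_sum_mult:
  assumes F: "orthogonal_idempotents F" and G: "finite G" "G \<subseteq> F" "E \<in> G"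
  shows "(\<Sum>D\<in>G. c D *\<^sub>R D) \<circ>\<^sub>J E = c E *\<^sub>R E"
proof -
  have "(\<Sum>D\<in>G. c D *\<^sub>R D) \<circ>\<^sub>J E = (\<Sum>D\<in>G. c D *\<^sub>R (D \<circ>\<^sub>J E))"
    by (simp add: jordan_prod.sum_left jordan_prod.scaleR_left)
  also have "\<dots> = (\<Sum>D\<in>G. if D = E then c E *\<^sub>R E else 0)"
    by (rule sum.cong) (use F G in \<open>auto simp: orthogonal_idempotents_def subset_eq\<close>)
  also have "\<dots> = c E *\<^sub>R E" using G by simp
  finally show ?thesis .
qed

lemma orthogonal_idempotents_independent:
  assumes F: "orthogonal_idempotents F"
  shows "independent F"
  unfolding dependent_explicit
proof clarify
  fix G c E
  assume G: "finite G" "G \<subseteq> F" and zero: "(\<Sum>D\<in>G. c D *\<^sub>R D) = 0" and E: "E \<in> G" "c E \<noteq> 0"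
  have "c E *\<^sub>R E = 0"
    using orthogonal_idempotents_sum_mult[OF F G E(1), of c] zero by (simp add: jordan_prod.zero_left)
  then show False using F E G by (auto simp: orthogonal_idempotents_def)
qed

lemma orthogonal_idempotents_bound:
  fixes F :: "(real^'n^'n) set"
  assumes "orthogonal_idempotents F"
  shows "finite F" "card F \<le> DIM(real^'n^'n)"
  using independent_bound[OF orthogonal_idempotents_independent[OF assms]] by blast+

section \<open>Spectral decompositions and their uniqueness\<close>

lemma spectral_decomposition_idempotents:
  assumes dec: "spectral_decomposition J X \<Lambda> E"
  shows "E ` \<Lambda> \<subseteq> J" "orthogonal_idempotents (E ` \<Lambda>)" "card (E ` \<Lambda>) = card \<Lambda>"
proof -
  \<comment> \<open>If \<open>E l = E m\<close> for distinct \<open>l\<close> and \<open>m\<close>,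
    then idempotency and orthogonality give \<open>E l = 0\<close>.\<close>
  have "inj_on E \<Lambda>"
    using dec unfolding spectral_decomposition_def inj_on_def by metis
  then show "card (E ` \<Lambda>) = card \<Lambda>" by (rule card_image)
  show "E ` \<Lambda> \<subseteq> J" "orthogonal_idempotents (E ` \<Lambda>)"
    using dec unfolding spectral_decomposition_def orthogonal_idempotents_def by auto
qed

text \<open>Passes from the Jordan product to the associative matrix product, in which triple
  products can be regrouped.\<close>

lemma spectral_decomposition_mult:
  assumes dec: "spectral_decomposition J X \<Lambda> E" and lm: "l \<in> \<Lambda>" "m \<in> \<Lambda>"
  shows "E l ** E m = (if l = m then E l else 0)"
proof -
  have idem: "E l \<circ>\<^sub>J E l = E l" "E m \<circ>\<^sub>J E m = E m" and orth: "l \<noteq> m \<Longrightarrow> E l \<circ>\<^sub>J E m = 0"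
    using dec lm by (auto simp: spectral_decomposition_def)
  show ?thesis
    using matrix_mult_eq_0[OF idem orth] idem(1)[unfolded idempotent_iff] by auto
qed

lemma matrix_mult_sum:
  fixes B :: "real^'n^'n"
  shows "(\<Sum>i\<in>I. c i *\<^sub>R A i) ** B = (\<Sum>i\<in>I. c i *\<^sub>R (A i ** B))"
    and "B ** (\<Sum>i\<in>I. c i *\<^sub>R A i) = (\<Sum>i\<in>I. c i *\<^sub>R (B ** A i))"
  by (induction I rule: infinite_finite_induct)
    (simp_all add: matrix_add_ldistrib matrix_add_rdistrib scaleR_matrix_mult_left
      scaleR_matrix_mult_right)

text \<open>For the idempotents \<open>E\<^sub>l\<close>, \<open>D\<^sub>m\<close> of two decompositions of \<open>X\<close>, evaluating the matrix product
  \<open>D\<^sub>m X E\<^sub>l\<close> in two ways gives \<open>(l - m) D\<^sub>m E\<^sub>l = 0\<close>.\<close>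

lemma spectral_decomposition_unique:
  assumes dec: "spectral_decomposition J X \<Lambda> E" and dec': "spectral_decomposition J X M D"
  shows "\<Lambda> \<subseteq> M"
proof
  fix l assume l: "l \<in> \<Lambda>"
  have El: "E l \<in> J" "E l \<noteq> 0" "E l \<circ>\<^sub>J E l = E l"
    using dec l by (auto simp: spectral_decomposition_def)
  have XE: "X ** E l = l *\<^sub>R E l"
  proof -
    have "X ** E l = (\<Sum>m\<in>\<Lambda>. m *\<^sub>R (E m ** E l))"
      using dec by (simp add: spectral_decomposition_def matrix_mult_sum)
    also have "\<dots> = (\<Sum>m\<in>\<Lambda>. if m = l then l *\<^sub>R E l else 0)"
      by (rule sum.cong)
        (use spectral_decomposition_mult[OF dec _ l] in auto)
    finally show ?thesis using dec l by (simp add: spectral_decomposition_def)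
  qed
  have DX: "D m ** X = m *\<^sub>R D m" if m: "m \<in> M" for m
  proof -
    have "D m ** X = (\<Sum>k\<in>M. k *\<^sub>R (D m ** D k))"
      using dec' by (simp add: spectral_decomposition_def matrix_mult_sum)
    also have "\<dots> = (\<Sum>k\<in>M. if k = m then m *\<^sub>R D m else 0)"
      by (rule sum.cong)
        (use spectral_decomposition_mult[OF dec' m] in auto)
    finally show ?thesis using dec' m by (simp add: spectral_decomposition_def)
  qed
  show "l \<in> M"
  proof (rule ccontr)
    assume "l \<notin> M"
    have DE: "D m ** E l = 0" if m: "m \<in> M" for m
    proof -
      have "m *\<^sub>R (D m ** E l) = D m ** X ** E l"
        using DX[OF m] by (simp add: scaleR_matrix_mult_left)
      also have "\<dots> = l *\<^sub>R (D m ** E l)"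
        by (simp add: XE scaleR_matrix_mult_right flip: matrix_mul_assoc)
      finally show ?thesis using m \<open>l \<notin> M\<close> by auto
    qed
    \<comment> \<open>Summing the vanishing products over \<open>M\<close> shows that the unit
      annihilates \<open>E l\<close>, although it must also fix it.\<close>
    define U where "U = (\<Sum>m\<in>M. D m)"
    have "jordan_unit J U" using dec' by (simp add: spectral_decomposition_def U_def)
    then have "U ** E l = E l"
      using El by (intro idempotent_unit_mult) (auto simp: jordan_unit_def)
    moreover have "U ** E l = 0"
      unfolding U_def using matrix_mult_sum(1)[of "\<lambda>_. 1" D M "E l"] DE by simp
    ultimately show False using El by simp
  qed
qed

lemma jordan_eigenvalues_eq:
  assumes "spectral_decomposition J X \<Lambda> E"
  shows "jordan_eigenvalues J X = \<Lambda>"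
  using assms spectral_decomposition_unique unfolding jordan_eigenvalues_def by blast

section \<open>The rank as the largest size of a family of orthogonal idempotents\<close>

lemma card_jordan_eigenvalues:
  obtains F where "F \<subseteq> J" "orthogonal_idempotents F" "card F = card (jordan_eigenvalues J X)"
proof (cases "\<exists>\<Lambda> E. spectral_decomposition J X \<Lambda> E")
  case True
  then obtain \<Lambda> E where dec: "spectral_decomposition J X \<Lambda> E" by blast
  show ?thesis
    using that[of "E ` \<Lambda>"] spectral_decomposition_idempotents[OF dec] jordan_eigenvalues_eq[OF dec]
    by simp
next
  \<comment> \<open>An element without a spectral decomposition has no eigenvalues in
    \<open>J\<close>, so the empty family serves.\<close>
  case False
  then have "jordan_eigenvalues J X = {}" by (simp add: jordan_eigenvalues_def)
  then show ?thesis using that[of "{}"] by (simp add: orthogonal_idempotents_def)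
qed

text \<open>Ensures that the \<open>Max\<close> in \<open>jordan_rank\<close> is a true maximum; the
  dimension of the matrix space bounds the number of eigenvalues.\<close>

lemma finite_card_jordan_eigenvalues:
  fixes J :: "(real^'n^'n) set"
  shows "finite ((\<lambda>X. card (jordan_eigenvalues J X)) ` J)"
proof (rule finite_subset)
  show "(\<lambda>X. card (jordan_eigenvalues J X)) ` J \<subseteq> {..DIM(real^'n^'n)}"
  proof (rule image_subsetI)
    fix X
    show "card (jordan_eigenvalues J X) \<in> {..DIM(real^'n^'n)}"
      using card_jordan_eigenvalues[of J X] orthogonal_idempotents_bound(2) by (metis atMost_iff)
  qed
qed simp

lemma jordan_rank_attained:
  assumes "J \<noteq> {}"
  obtains F where "F \<subseteq> J" "orthogonal_idempotents F" "card F = jordan_rank J"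
proof -
  have "jordan_rank J \<in> (\<lambda>X. card (jordan_eigenvalues J X)) ` J"
    unfolding jordan_rank_def using finite_card_jordan_eigenvalues assms by (intro Max_in) auto
  then show ?thesis using card_jordan_eigenvalues that by (metis imageE)
qed

text \<open>Giving the members of \<open>F\<close> pairwise distinct real coefficients produces an
  element of \<open>J\<close> with exactly \<open>card F\<close> eigenvalues.\<close>

lemma card_complete_idempotents_le_jordan_rank:
  assumes J: "subspace J" and F: "orthogonal_idempotents F" "F \<subseteq> J" and unit: "jordan_unit J (\<Sum>F)"
  shows "card F \<le> jordan_rank J"
proof -
  have fin: "finite F" using F(1) by (rule orthogonal_idempotents_bound)
  \<comment> \<open>Any injection into the reals would do as a choice of eigenvalues; this one
    numbers the members of \<open>F\<close>.\<close>
  obtain g :: "_ \<Rightarrow> nat" where g: "inj_on g F"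
    using finite_imp_inj_to_nat_seg[OF fin] by blast
  define h where "h = real \<circ> g"
  have h: "inj_on h F" unfolding h_def using g by (intro comp_inj_on) auto
  define E where "E = the_inv_into F h"
  have E: "E (h D) = D" if "D \<in> F" for D
    unfolding E_def using h that by (rule the_inv_into_f_f)
  define X where "X = (\<Sum>l\<in>h ` F. l *\<^sub>R E l)"
  have "spectral_decomposition J X (h ` F) E"
    unfolding spectral_decomposition_def
    using F fin unit h
    by (auto simp: E X_def orthogonal_idempotents_def sum.reindex)
  then have "jordan_eigenvalues J X = h ` F" by (rule jordan_eigenvalues_eq)
  then have "card (jordan_eigenvalues J X) = card F" using h by (simp add: card_image)
  moreover have "X \<in> J"
    unfolding X_def using J F E by (auto intro!: subspace_sum subspace_scale)
  ultimately show ?thesis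
    unfolding jordan_rank_def using finite_card_jordan_eigenvalues[of J]
    by (metis (mono_tags, lifting) Max_ge image_eqI)
qed

text \<open>A family that does not sum to the unit is completed by one further idempotent, the
  difference from the unit, which only increases its size.\<close>

lemma card_le_jordan_rank:
  assumes J: "subspace J" and F: "orthogonal_idempotents F" "F \<subseteq> J" and unit: "jordan_unit J U"
  shows "card F \<le> jordan_rank J"
proof -
  have fin: "finite F" using F(1) by (rule orthogonal_idempotents_bound)
  define R where "R = U - \<Sum>F"
  have sum_J: "\<Sum>F \<in> J" using J F by (intro subspace_sum) auto
  have U: "U \<in> J" "\<And>X. X \<in> J \<Longrightarrow> X \<circ>\<^sub>J U = X" "\<And>X. X \<in> J \<Longrightarrow> U \<circ>\<^sub>J X = X"
    using unit by (auto simp: jordan_unit_def jordan_prod_commute[of U])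
  have sum_mult: "\<Sum>F \<circ>\<^sub>J D = D" if "D \<in> F" for D
    using orthogonal_idempotents_sum_mult[OF F(1) fin subset_refl that, of "\<lambda>_. 1"] by simp
  then have RD: "R \<circ>\<^sub>J D = 0" if "D \<in> F" for D
    using that F(2) U by (auto simp: R_def jordan_prod.diff_left)
  then have DR: "D \<circ>\<^sub>J R = 0" if "D \<in> F" for D using that by (simp add: jordan_prod_commute[of D])
  have "R \<circ>\<^sub>J \<Sum>F = 0" using RD by (simp add: jordan_prod.sum_right)
  moreover have "R \<circ>\<^sub>J U = R" using U sum_J by (simp add: R_def jordan_prod.diff_left)
  \<comment> \<open>Expanding the second factor: \<open>R \<circ>\<^sub>J R\<close> is
    \<open>R \<circ>\<^sub>J U\<close> minus \<open>R \<circ>\<^sub>J \<Sum>F\<close>, that is,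
    \<open>R\<close> minus 0.\<close>
  ultimately have RR: "R \<circ>\<^sub>J R = R" by (subst (2) R_def) (simp add: jordan_prod.diff_right)
  have R_J: "R \<in> J" unfolding R_def using J U sum_J by (intro subspace_diff) auto
  show ?thesis
  proof (cases "R = 0")
    case True
    then show ?thesis
      using card_complete_idempotents_le_jordan_rank[OF J F] unit by (simp add: R_def)
  next
    case False
    have "R \<notin> F" using RD RR False by metis
    moreover have "orthogonal_idempotents (insert R F)"
      using F(1) False RR RD DR by (auto simp: orthogonal_idempotents_def)
    moreover have "\<Sum>(insert R F) = U" using \<open>R \<notin> F\<close> fin by (simp add: R_def)
    ultimately have "card (insert R F) \<le> jordan_rank J"
      using card_complete_idempotents_le_jordan_rank[OF J, of "insert R F"] F R_J unit by simp
    then show ?thesis using \<open>R \<notin> F\<close> fin by simp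
  qed
qed

section \<open>Direct sums of ideals\<close>

lemma direct_sum_ofE:
  assumes "direct_sum_of J As" "X \<in> J"
  obtains f where "\<And>i. i < length As \<Longrightarrow> f i \<in> As ! i" "X = (\<Sum>i<length As. f i)"
proof -
  from assms obtain f where "f \<in> (\<Pi>\<^sub>E i\<in>{..<length As}. As ! i)" "X = (\<Sum>i<length As. f i)"
    unfolding direct_sum_of_def bij_betw_def by blast
  then show thesis using that by auto
qed

lemma direct_sum_of_disjoint:
  assumes sum: "direct_sum_of J As" and sub: "\<And>A. A \<in> set As \<Longrightarrow> subspace A"
    and ij: "i < length As" "j < length As" "i \<noteq> j" and X: "X \<in> As ! i" "X \<in> As ! j"
  shows "X = 0"
proof -
  \<comment> \<open>The tuple with \<open>X\<close> in slot \<open>k\<close> and 0 elsewhere. The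
    tuples for \<open>i\<close> and \<open>j\<close> have the same sum \<open>X\<close>, so
    injectivity of addition identifies them.\<close>
  define f where "f k = (\<lambda>m\<in>{..<length As}. if m = k then X else 0)" for k
  have zero: "0 \<in> As ! m" if "m < length As" for m using sub that by (simp add: subspace_0)
  have "f i \<in> (\<Pi>\<^sub>E i\<in>{..<length As}. As ! i)" "f j \<in> (\<Pi>\<^sub>E i\<in>{..<length As}. As ! i)"
    using X zero by (auto simp: f_def)
  moreover have "(\<Sum>m<length As. f i m) = (\<Sum>m<length As. f j m)"
    using ij by (simp add: f_def)
  ultimately have "f i = f j"
    using sum unfolding direct_sum_of_def bij_betw_def inj_on_def by blast
  then have "f i i = f j i" by simp
  then show ?thesis using ij by (simp add: f_def)
qed

text \<open>The product lies in both ideals, and these meet only in 0.\<close>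

lemma direct_sum_of_ideals_mult_0:
  assumes sum: "direct_sum_of J As" and ideal: "\<And>A. A \<in> set As \<Longrightarrow> jordan_ideal A J"
    and ij: "i < length As" "j < length As" "i \<noteq> j" and "X \<in> As ! i" "Z \<in> As ! j"
  shows "X \<circ>\<^sub>J Z = 0"
proof (rule direct_sum_of_disjoint[OF sum _ ij])
  show "subspace A" if "A \<in> set As" for A using ideal[OF that] by (simp add: jordan_ideal_def)
  have I: "jordan_ideal (As ! i) J" "jordan_ideal (As ! j) J" using ideal ij by simp_all
  show "X \<circ>\<^sub>J Z \<in> As ! i" using I \<open>X \<in> As ! i\<close> \<open>Z \<in> As ! j\<close> by (auto simp: jordan_ideal_def)
  have "Z \<circ>\<^sub>J X \<in> As ! j" using I \<open>X \<in> As ! i\<close> \<open>Z \<in> As ! j\<close> by (auto simp: jordan_ideal_def)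
  then show "X \<circ>\<^sub>J Z \<in> As ! j" by (simp add: jordan_prod_commute)
qed

text \<open>\<open>Z\<close> annihilates every summand but the \<open>k\<close>-th. When
  \<open>Z\<close> is the unit of that summand, multiplication by it is the projection onto the
  component \<open>f k\<close>.\<close>

lemma direct_sum_of_ideals_mult_component:
  assumes sum: "direct_sum_of J As" and ideal: "\<And>A. A \<in> set As \<Longrightarrow> jordan_ideal A J"
    and f: "\<And>i. i < length As \<Longrightarrow> f i \<in> As ! i" and k: "k < length As" and Z: "Z \<in> As ! k"
  shows "(\<Sum>i<length As. f i) \<circ>\<^sub>J Z = f k \<circ>\<^sub>J Z"
proof -
  have "(\<Sum>i<length As. f i) \<circ>\<^sub>J Z = (\<Sum>i<length As. if i = k then f k \<circ>\<^sub>J Z else 0)"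
    unfolding jordan_prod.sum_left
    by (rule sum.cong) (use f k Z direct_sum_of_ideals_mult_0[OF sum ideal] in auto)
  then show ?thesis using k by simp
qed

text \<open>The components of \<open>U\<close> are the units: on \<open>As ! k\<close>,
  multiplication by \<open>U\<close> agrees with multiplication by its \<open>k\<close>-th
  component.\<close>

lemma direct_sum_of_ideals_unit:
  assumes sum: "direct_sum_of J As" and ideal: "\<And>A. A \<in> set As \<Longrightarrow> jordan_ideal A J"
    and unit: "jordan_unit J U"
  obtains e where "\<And>k. k < length As \<Longrightarrow> jordan_unit (As ! k) (e k)"
proof -
  from unit have "U \<in> J" by (simp add: jordan_unit_def)
  then obtain e where e: "\<And>i. i < length As \<Longrightarrow> e i \<in> As ! i" "U = (\<Sum>i<length As. e i)"
    using direct_sum_ofE[OF sum] by blast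
  have "jordan_unit (As ! k) (e k)" if k: "k < length As" for k
    unfolding jordan_unit_def
  proof (intro conjI ballI)
    show "e k \<in> As ! k" using e k by simp
    fix X assume X: "X \<in> As ! k"
    then have "X \<in> J" using ideal[of "As ! k"] k by (auto simp: jordan_ideal_def)
    have "X \<circ>\<^sub>J e k = U \<circ>\<^sub>J X"
      using direct_sum_of_ideals_mult_component[OF sum ideal e(1) k X] e(2)
      by (simp add: jordan_prod_commute)
    also have "\<dots> = X" using unit \<open>X \<in> J\<close> by (metis jordan_prod_commute jordan_unit_def)
    finally show "X \<circ>\<^sub>J e k = X" .
  qed
  then show thesis using that by blast
qed

text \<open>Products in \<open>J\<close> are formed componentwise, and multiplication by
  \<open>U\<close> extracts the \<open>k\<close>-th component.\<close>

lemma direct_sum_of_ideals_component_hom: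
  assumes sum: "direct_sum_of J As" and ideal: "\<And>A. A \<in> set As \<Longrightarrow> jordan_ideal A J"
    and k: "k < length As" and unit: "jordan_unit (As ! k) U" and XZ: "X \<in> J" "Z \<in> J"
  shows "(X \<circ>\<^sub>J Z) \<circ>\<^sub>J U = (X \<circ>\<^sub>J U) \<circ>\<^sub>J (Z \<circ>\<^sub>J U)"
proof -
  obtain f where f: "\<And>i. i < length As \<Longrightarrow> f i \<in> As ! i" "X = (\<Sum>i<length As. f i)"
    using direct_sum_ofE[OF sum XZ(1)] by blast
  obtain g where g: "\<And>i. i < length As \<Longrightarrow> g i \<in> As ! i" "Z = (\<Sum>i<length As. g i)"
    using direct_sum_ofE[OF sum XZ(2)] by blast
  have sub: "As ! i \<subseteq> J" if "i < length As" for i using ideal that by (auto simp: jordan_ideal_def)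
  have U: "U \<in> As ! k" "\<And>W. W \<in> As ! k \<Longrightarrow> W \<circ>\<^sub>J U = W" using unit by (auto simp: jordan_unit_def)
  have fg: "f i \<circ>\<^sub>J g i \<in> As ! i" if i: "i < length As" for i
    using ideal[of "As ! i"] f(1)[OF i] g(1)[OF i] sub[OF i] i by (auto simp: jordan_ideal_def)
  have "f i \<circ>\<^sub>J Z = f i \<circ>\<^sub>J g i" if "i < length As" for i
    using direct_sum_of_ideals_mult_component[OF sum ideal g(1) that f(1)[OF that]] g(2)
    by (metis jordan_prod_commute)
  then have "X \<circ>\<^sub>J Z = (\<Sum>i<length As. f i \<circ>\<^sub>J g i)" by (simp add: f(2) jordan_prod.sum_left)
  then have "(X \<circ>\<^sub>J Z) \<circ>\<^sub>J U = f k \<circ>\<^sub>J g k"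
    using direct_sum_of_ideals_mult_component[OF sum ideal fg k U(1)] fg U k by simp
  moreover have "X \<circ>\<^sub>J U = f k" "Z \<circ>\<^sub>J U = g k"
    using direct_sum_of_ideals_mult_component[OF sum ideal _ k U(1)] f g U k by simp_all
  ultimately show ?thesis by simp
qed

section \<open>Carrying idempotents of one decomposition into the summands of another\<close>

lemma orthogonal_idempotents_hom_image:
  assumes F: "orthogonal_idempotents F"
    and hom: "\<And>X Z. X \<in> F \<Longrightarrow> Z \<in> F \<Longrightarrow> h (X \<circ>\<^sub>J Z) = h X \<circ>\<^sub>J h Z" "h 0 = 0"
    and nz: "\<And>X. X \<in> F \<Longrightarrow> h X \<noteq> 0"
  shows "orthogonal_idempotents (h ` F)" "card (h ` F) = card F"
proof -
  have idem: "h X \<circ>\<^sub>J h X = h X" if "X \<in> F" for X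
    using F hom that by (metis orthogonal_idempotents_def)
  have orth: "h X \<circ>\<^sub>J h Z = 0" if "X \<in> F" "Z \<in> F" "X \<noteq> Z" for X Z
    using F hom that by (metis orthogonal_idempotents_def)
  \<comment> \<open>Distinct members with a common image would make that image both idempotent and
    orthogonal to itself, hence 0.\<close>
  have "inj_on h F" using idem orth nz by (metis inj_onI)
  then show "card (h ` F) = card F" by (rule card_image)
  show "orthogonal_idempotents (h ` F)"
    unfolding orthogonal_idempotents_def using idem orth nz by fastforce
qed

text \<open>The kernel in \<open>A\<close> of a component map is an ideal of \<open>A\<close>, hence
  \<open>{0}\<close> or \<open>A\<close>. Taking \<open>k\<close> such that some element of
  \<open>A\<close> has a nonzero \<open>k\<close>-th component excludes \<open>A\<close>.\<close>

lemma simple_ideal_injective_component: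
  assumes simple: "simple_ideal A S" and S: "S \<subseteq> J" and sum: "direct_sum_of J As"
    and ideal: "\<And>B. B \<in> set As \<Longrightarrow> jordan_ideal B J"
    and unit: "\<And>k. k < length As \<Longrightarrow> jordan_unit (As ! k) (e k)"
  obtains k where "k < length As" "\<And>X. X \<in> A \<Longrightarrow> X \<noteq> 0 \<Longrightarrow> X \<circ>\<^sub>J e k \<noteq> 0"
proof -
  have A: "subspace A" "A \<subseteq> S" "\<And>X Z. X \<in> A \<Longrightarrow> Z \<in> A \<Longrightarrow> X \<circ>\<^sub>J Z \<in> A" "A \<noteq> {0}"
    and simple_A: "\<And>I. jordan_ideal I A \<Longrightarrow> I = {0} \<or> I = A"
    using simple by (auto simp: simple_ideal_def jordan_ideal_def jordan_simple_def)
  obtain X where X: "X \<in> A" "X \<noteq> 0" using A subspace_0 by blast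
  then have "X \<in> J" using A S by blast
  then obtain f where f: "\<And>i. i < length As \<Longrightarrow> f i \<in> As ! i" "X = (\<Sum>i<length As. f i)"
    using direct_sum_ofE[OF sum] by blast
  obtain k where k: "k < length As" "f k \<noteq> 0"
    using X f(2) by (metis (no_types, lifting) lessThan_iff sum.neutral)
  have e: "e k \<in> As ! k" "f k \<circ>\<^sub>J e k = f k" using unit f k by (auto simp: jordan_unit_def)
  have Xk: "X \<circ>\<^sub>J e k \<noteq> 0"
    using direct_sum_of_ideals_mult_component[OF sum ideal f(1) k(1) e(1)] f(2) e k by simp
  \<comment> \<open>The kernel of the \<open>k\<close>-th component map on \<open>A\<close>.\<close>
  define I where "I = {Z\<in>A. Z \<circ>\<^sub>J e k = 0}"
  have "jordan_ideal I A"
    unfolding jordan_ideal_def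
  proof (intro conjI ballI)
    show "subspace I"
      using A(1)
      by (auto simp: I_def subspace_def jordan_prod.add_left jordan_prod.scaleR_left
          jordan_prod.zero_left)
    show "V \<circ>\<^sub>J Z \<in> I" if "V \<in> I" "Z \<in> A" for V Z
    proof -
      have "V \<in> J" "Z \<in> J" using that A S by (auto simp: I_def)
      then have "(V \<circ>\<^sub>J Z) \<circ>\<^sub>J e k = (V \<circ>\<^sub>J e k) \<circ>\<^sub>J (Z \<circ>\<^sub>J e k)"
        using direct_sum_of_ideals_component_hom[OF sum ideal k(1) unit[OF k(1)]] by blast
      then show ?thesis using that A by (auto simp: I_def jordan_prod.zero_left)
    qed
  qed (auto simp: I_def)
  then have "I = {0}" using simple_A X Xk by (auto simp: I_def)
  then have "Z \<circ>\<^sub>J e k \<noteq> 0" if "Z \<in> A" "Z \<noteq> 0" for Z using that by (auto simp: I_def)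
  then show thesis using that k(1) by blast
qed

lemma rank_vector_weakly_majorizes_subalgebra:
  assumes sub: "S \<subseteq> W" and unit: "jordan_unit W U"
    and Ss: "simple_ideal_decomposition S Ss" and Ws: "simple_ideal_decomposition W Ws"
  shows "weakly_majorizes (rank_vector Ws) (rank_vector Ss)"
proof -
  have sumS: "direct_sum_of S Ss" and sumW: "direct_sum_of W Ws"
    and simpleS: "\<And>A. A \<in> set Ss \<Longrightarrow> simple_ideal A S"
    and idealS: "\<And>A. A \<in> set Ss \<Longrightarrow> jordan_ideal A S"
    and idealW: "\<And>A. A \<in> set Ws \<Longrightarrow> jordan_ideal A W"
    using Ss Ws by (auto simp: simple_ideal_decomposition_def simple_ideal_def)
  obtain e where e: "\<And>k. k < length Ws \<Longrightarrow> jordan_unit (Ws ! k) (e k)"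
    using direct_sum_of_ideals_unit[OF sumW idealW unit] by blast
  have "\<exists>k<length Ws. \<forall>X\<in>Ss ! i. X \<noteq> 0 \<longrightarrow> X \<circ>\<^sub>J e k \<noteq> 0" if "i < length Ss" for i
    using simple_ideal_injective_component[OF simpleS sub sumW idealW e] that by (metis nth_mem)
  then obtain f where f: "\<And>i. i < length Ss \<Longrightarrow> f i < length Ws"
    and inj: "\<And>i X. i < length Ss \<Longrightarrow> X \<in> Ss ! i \<Longrightarrow> X \<noteq> 0 \<Longrightarrow> X \<circ>\<^sub>J e (f i) \<noteq> 0"
    by metis
  have subS: "subspace (Ss ! i)" "Ss ! i \<subseteq> S" if "i < length Ss" for i
    using idealS that by (auto simp: jordan_ideal_def)
  have "\<exists>F \<subseteq> Ss ! i. orthogonal_idempotents F \<and> card F = jordan_rank (Ss ! i)"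
    if "i < length Ss" for i
    using jordan_rank_attained[of "Ss ! i"] subspace_0[OF subS(1)[OF that]] by (metis empty_iff)
  then obtain F where F: "\<And>i. i < length Ss \<Longrightarrow> F i \<subseteq> Ss ! i"
      "\<And>i. i < length Ss \<Longrightarrow> orthogonal_idempotents (F i)"
      "\<And>i. i < length Ss \<Longrightarrow> card (F i) = jordan_rank (Ss ! i)"
    by metis
  show ?thesis
  proof (rule weakly_majorizesI)
    fix k assume "k < length (rank_vector Ws)"
    then have k: "k < length Ws" by (simp add: rank_vector_def)
    define I where "I = {i. i < length Ss \<and> f i = k}"
    \<comment> \<open>All idempotents chosen in the summands of \<open>S\<close> that
      \<open>f\<close> sends to \<open>k\<close>; their number is the sum of the ranks of these
      summands.\<close>
    define G where "G = (\<Union>i\<in>I. F i)"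
    have orthG: "E \<circ>\<^sub>J E' = 0" if "E \<in> F i" "E' \<in> F j" "i \<in> I" "j \<in> I" "i \<noteq> j" for E E' i j
      using direct_sum_of_ideals_mult_0[OF sumS idealS, of i j] F(1)[of i] F(1)[of j] that
      by (auto simp: I_def)
    have orthG': "E \<circ>\<^sub>J E' = 0" if "E \<in> G" "E' \<in> G" "E \<noteq> E'" for E E'
    proof -
      obtain i j where ij: "i \<in> I" "E \<in> F i" "j \<in> I" "E' \<in> F j"
        using \<open>E \<in> G\<close> \<open>E' \<in> G\<close> by (auto simp: G_def)
      show ?thesis
      proof (cases "i = j")
        case True
        then show ?thesis using ij F(2)[of i] that by (auto simp: I_def orthogonal_idempotents_def)
      qed (use ij orthG in blast)
    qed
    have idem: "0 \<notin> F i" "\<And>E. E \<in> F i \<Longrightarrow> E \<circ>\<^sub>J E = E" if "i \<in> I" for i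
      using F(2) that by (auto simp: I_def orthogonal_idempotents_def)
    have G: "orthogonal_idempotents G"
      unfolding orthogonal_idempotents_def using idem orthG' by (auto simp: G_def)
    \<comment> \<open>A common member would be orthogonal to itself and idempotent, hence 0, which
      the families exclude.\<close>
    have "F i \<inter> F j = {}" if "i \<in> I" "j \<in> I" "i \<noteq> j" for i j
      using orthG idem that by (metis disjoint_iff)
    moreover have "finite (F i)" if "i \<in> I" for i
      using F(2)[THEN orthogonal_idempotents_bound(1)] that by (simp add: I_def)
    moreover have "finite I" by (simp add: I_def)
    ultimately have "card G = (\<Sum>i\<in>I. card (F i))"
      unfolding G_def by (intro card_UN_disjoint) auto
    also have "\<dots> = (\<Sum>i\<in>I. jordan_rank (Ss ! i))"
      by (rule sum.cong) (auto simp: I_def F(3))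
    finally have card_G: "card G = (\<Sum>i\<in>I. jordan_rank (Ss ! i))" .
    have GW: "G \<subseteq> W" using F(1) subS sub by (fastforce simp: G_def I_def)
    define h where "h X = X \<circ>\<^sub>J e k" for X
    have hom: "h (X \<circ>\<^sub>J Z) = h X \<circ>\<^sub>J h Z" if "X \<in> G" "Z \<in> G" for X Z
      unfolding h_def using direct_sum_of_ideals_component_hom[OF sumW idealW k e[OF k]] that GW
      by blast
    \<comment> \<open>Each member of \<open>G\<close> is a nonzero element of some
      \<open>Ss ! i\<close> with \<open>f i = k\<close>, where multiplication by \<open>e k\<close>
      is injective.\<close>
    have nz: "h X \<noteq> 0" if "X \<in> G" for X
      using that inj F(1) idem(1) unfolding h_def G_def I_def by blast
    have image: "orthogonal_idempotents (h ` G)" "card (h ` G) = card G"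
      using orthogonal_idempotents_hom_image[OF G hom _ nz] by (simp_all add: h_def jordan_prod.zero_left)
    have Wk: "jordan_ideal (Ws ! k) W" using idealW k by simp
    have "h ` G \<subseteq> Ws ! k"
    proof clarify
      fix X assume "X \<in> G"
      \<comment> \<open>The factors are swapped because \<open>jordan_ideal\<close> expects the
        element of the ideal on the left.\<close>
      then have "e k \<circ>\<^sub>J X \<in> Ws ! k"
        using Wk e[OF k] GW by (auto simp: jordan_ideal_def jordan_unit_def)
      then show "h X \<in> Ws ! k" by (simp add: h_def jordan_prod_commute)
    qed
    then have "card G \<le> jordan_rank (Ws ! k)"
      using card_le_jordan_rank[OF _ image(1) _ e[OF k]] Wk image(2) by (simp add: jordan_ideal_def)
    then have "(\<Sum>i\<in>I. int (jordan_rank (Ss ! i))) \<le> int (jordan_rank (Ws ! k))"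
      using card_G by (metis of_nat_le_iff of_nat_sum)
    moreover have "{i. i < length (rank_vector Ss) \<and> f i = k} = I"
      by (simp add: I_def rank_vector_def)
    moreover have "(\<Sum>i\<in>I. rank_vector Ss ! i) = (\<Sum>i\<in>I. int (jordan_rank (Ss ! i)))"
      by (rule sum.cong) (auto simp: I_def rank_vector_def)
    ultimately show "(\<Sum>i | i < length (rank_vector Ss) \<and> f i = k. rank_vector Ss ! i)
        \<le> rank_vector Ws ! k"
      using k by (simp add: rank_vector_def)
  qed (use f in \<open>auto simp: rank_vector_def\<close>)
qed

theorem theorem4p1:
  fixes L W :: "(real^'n^'n) set" and C Y :: "real^'n^'n"
    and Ss Ws :: "(real^'n^'n) set list"
  assumes "subspace L" and "L \<subseteq> sym_mats"
    and "C \<in> sym_mats" and "Y \<in> sym_mats"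
    and "admissible C Y L W"
    and "simple_ideal_decomposition (S_opt C Y L) Ss"
    and "simple_ideal_decomposition W Ws"
  shows "weakly_majorizes (rank_vector Ws) (rank_vector Ss)"
proof -
  have "S_opt C Y L \<subseteq> W" using assms(5) by (auto simp: S_opt_def)
  moreover obtain U where "jordan_unit W U" using assms(5) by (auto simp: admissible_def)
  ultimately show ?thesis
    using rank_vector_weakly_majorizes_subalgebra assms(6,7) by blast
qed

end
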